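(* For a Banach lattice $E$, the following assertions are equivalent: (1) $E$ has property (d). (2) Every order interval in $E$ is almost limited. (3) The solid hull of every almost limited subset of $E$ is also almost limited.
   Context: All Banach spaces and Banach lattices are real; $E'$ denotes the topological dual of $E$, a Banach lattice with the dual order. A sequence $(f_n)$ in a Banach lattice is disjoint if $|f_n| \wedge |f_m| = 0$ for $n \neq m$. A Banach lattice $E$ has property (d) if $|f_n| \to 0$ in the weak* topology for every disjoint weak* null sequence $(f_n) \subset E'$. A bounded set $A \subset E$ is almost limited if every disjoint weak* null sequence $(f_n)$ in $E'$ converges uniformly to zero on $A$, i.e. $\sup_{x \in A} |f_n(x)| \to 0$. A set $S \subset E$ is solid if $|y| \leq |x|$ with $x \in S$ implies $y \in S$; the solid hull $\mathrm{sol}(A)$ is the smallest solid set containing $A$. *)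

theory Defs
  imports "HOL-Analysis.Analysis" "HOL-Library.Lattice_Algebras"
begin

section \<open>Banach lattices\<close>

class banach_lattice = banach + ordered_real_vector + lattice_ab_group_add_abs +
  assumes norm_mono_abs: "\<bar>x\<bar> \<le> \<bar>y\<bar> \<Longrightarrow> norm x \<le> norm y"

instance real :: banach_lattice
  by standard (auto simp: sup_real_def abs_if)

section \<open>The dual Banach lattice\<close>

text \<open>The topological dual of \<open>'a\<close> is \<open>'a \<Rightarrow>\<^sub>L real\<close>, ordered by
  \<open>f \<le> g\<close> iff \<open>f x \<le> g x\<close> for all \<open>x \<ge> 0\<close>.\<close>

instantiation blinfun :: (banach_lattice, "{real_normed_vector, ordered_ab_group_add}") order
begin

definition less_eq_blinfun :: "('a \<Rightarrow>\<^sub>L 'b) \<Rightarrow> ('a \<Rightarrow>\<^sub>L 'b) \<Rightarrow> bool" where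
  "less_eq_blinfun f g \<longleftrightarrow> (\<forall>x\<ge>0. blinfun_apply f x \<le> blinfun_apply g x)"

definition less_blinfun :: "('a \<Rightarrow>\<^sub>L 'b) \<Rightarrow> ('a \<Rightarrow>\<^sub>L 'b) \<Rightarrow> bool" where
  "less_blinfun f g \<longleftrightarrow> f \<le> g \<and> \<not> g \<le> f"

instance
proof
  fix f g h :: "'a \<Rightarrow>\<^sub>L 'b"
  show "f < g \<longleftrightarrow> f \<le> g \<and> \<not> g \<le> f" by (rule less_blinfun_def)
  show "f \<le> f" by (simp add: less_eq_blinfun_def)
  show "f \<le> h" if "f \<le> g" "g \<le> h"
    using that unfolding less_eq_blinfun_def by (meson order_trans)
  show "f = g" if "f \<le> g" "g \<le> f"
  proof (rule blinfun_eqI)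
    fix x :: 'a
    have pos: "blinfun_apply f y = blinfun_apply g y" if "0 \<le> y" for y
      using that \<open>f \<le> g\<close> \<open>g \<le> f\<close> unfolding less_eq_blinfun_def by (meson order_antisym)
    have x: "x = pprt x - pprt (- x)"
      using prts[of x] by (simp add: pprt_neg)
    show "blinfun_apply f x = blinfun_apply g x"
      by (subst (1 2) x) (simp add: blinfun.diff_right pos)
  qed
qed

end

text \<open>Modulus and meet are taken with respect to the dual order. They exist by the
  Riesz--Kantorovich theorem, see \<open>dual_abs_lub\<close> and \<open>dual_inf_glb\<close> below.\<close>

definition dual_abs :: "('a::banach_lattice \<Rightarrow>\<^sub>L real) \<Rightarrow> ('a \<Rightarrow>\<^sub>L real)" where
  "dual_abs f = (LEAST h. f \<le> h \<and> - f \<le> h)"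

definition dual_inf :: "('a::banach_lattice \<Rightarrow>\<^sub>L real) \<Rightarrow> ('a \<Rightarrow>\<^sub>L real) \<Rightarrow> ('a \<Rightarrow>\<^sub>L real)" where
  "dual_inf f g = (GREATEST h. h \<le> f \<and> h \<le> g)"

lemma abs_le_sum_split:
  fixes y :: "'a::banach_lattice"
  assumes "\<bar>y\<bar> \<le> a + b" "0 \<le> a" "0 \<le> b"
  obtains u v where "y = u + v" "\<bar>u\<bar> \<le> a" "\<bar>v\<bar> \<le> b"
proof
  define u where "u = sup (- a) (inf a y)"
  have y: "y \<le> a + b" "- y \<le> a + b"
    using assms(1) by (auto simp: abs_le_iff)
  show "y = u + (y - u)" by simp
  have "u \<le> a" "- a \<le> u"
    using assms(2) by (auto simp: u_def intro: order_trans[of _ 0])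
  then show "\<bar>u\<bar> \<le> a" by (simp add: abs_le_iff minus_le_iff)
  have "y - b \<le> inf a y"
    using y assms(3) by (simp add: algebra_simps)
  then have 1: "y - b \<le> u" unfolding u_def by (simp add: le_supI2)
  have "- a \<le> y + b"
    using add_right_mono[OF y(2), of "y - a"] by (simp add: algebra_simps)
  moreover have "inf a y \<le> y + b"
    using assms(3) by (simp add: le_infI2 add_increasing2)
  ultimately have 2: "u \<le> y + b" unfolding u_def by simp
  show "\<bar>y - u\<bar> \<le> b"
    using 1 2 by (simp add: abs_le_iff algebra_simps)
qed

lemma dual_modulus_exists:
  fixes f :: "'a::banach_lattice \<Rightarrow>\<^sub>L real"
  shows "\<exists>h. f \<le> h \<and> - f \<le> h \<and> (\<forall>k. f \<le> k \<and> - f \<le> k \<longrightarrow> h \<le> k)"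
proof -
  define p where "p x = (SUP y\<in>{y. \<bar>y\<bar> \<le> x}. blinfun_apply f y)" for x :: 'a
  have bnd: "blinfun_apply f y \<le> norm f * norm x" if "\<bar>y\<bar> \<le> x" for x y
  proof -
    have "\<bar>y\<bar> \<le> \<bar>x\<bar>" using that abs_ge_self order_trans by blast
    then have "norm y \<le> norm x" by (rule norm_mono_abs)
    then have "norm f * norm y \<le> norm f * norm x" by (simp add: mult_left_mono)
    moreover have "blinfun_apply f y \<le> norm f * norm y"
      using norm_blinfun[of f y] by simp
    ultimately show ?thesis by linarith
  qed
  have bdd: "bdd_above (blinfun_apply f ` {y. \<bar>y\<bar> \<le> x})" for x
    using bnd by (auto simp: bdd_above_def)
  have up: "blinfun_apply f y \<le> p x" if "\<bar>y\<bar> \<le> x" for x y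
    unfolding p_def using that by (intro cSUP_upper bdd) auto
  have lub: "p x \<le> c" if "0 \<le> x" "\<And>y. \<bar>y\<bar> \<le> x \<Longrightarrow> blinfun_apply f y \<le> c" for x c
    unfolding p_def using that by (intro cSUP_least) (auto intro!: exI[of _ 0])
  have p0: "0 \<le> p x" if "0 \<le> x" for x
    using up[of 0 x] that by (simp add: blinfun.zero_right)
  have pn: "p x \<le> norm f * norm x" if "0 \<le> x" for x
    using lub bnd that by blast
  have padd: "p (a + b) = p a + p b" if ab: "0 \<le> a" "0 \<le> b" for a b
  proof (rule antisym)
    show "p (a + b) \<le> p a + p b"
    proof (rule lub)
      show "0 \<le> a + b" using ab by simp
      fix y assume "\<bar>y\<bar> \<le> a + b"
      then obtain u v where "y = u + v" "\<bar>u\<bar> \<le> a" "\<bar>v\<bar> \<le> b"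
        using ab by (rule abs_le_sum_split)
      then show "blinfun_apply f y \<le> p a + p b"
        using up[of u a] up[of v b] by (simp add: blinfun.add_right)
    qed
    have "p a \<le> p (a + b) - p b"
    proof (rule lub[OF ab(1)])
      fix u assume u: "\<bar>u\<bar> \<le> a"
      have "p b \<le> p (a + b) - blinfun_apply f u"
      proof (rule lub[OF ab(2)])
        fix v assume v: "\<bar>v\<bar> \<le> b"
        have "\<bar>u + v\<bar> \<le> a + b"
          using abs_triangle_ineq[of u v] add_mono[OF u v] by (rule order_trans)
        from up[OF this] show "blinfun_apply f v \<le> p (a + b) - blinfun_apply f u"
          by (simp add: blinfun.add_right)
      qed
      then show "blinfun_apply f u \<le> p (a + b) - p b" by simp
    qed
    then show "p a + p b \<le> p (a + b)" by simp
  qed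
  have pscale_le: "r * p x \<le> p (r *\<^sub>R x)" if "0 < r" "0 \<le> x" for r x
  proof -
    have "p x \<le> p (r *\<^sub>R x) / r"
    proof (rule lub[OF that(2)])
      fix y assume y: "\<bar>y\<bar> \<le> x"
      have "y \<le> x" "- y \<le> x" using y by (auto simp: abs_le_iff)
      then have "r *\<^sub>R y \<le> r *\<^sub>R x" "r *\<^sub>R (- y) \<le> r *\<^sub>R x"
        using that(1) by (auto intro!: scaleR_left_mono simp del: scaleR_minus_right)
      then have "\<bar>r *\<^sub>R y\<bar> \<le> r *\<^sub>R x" by (simp add: abs_le_iff)
      from up[OF this] show "blinfun_apply f y \<le> p (r *\<^sub>R x) / r"
        using that(1) by (simp add: blinfun.scaleR_right field_simps)
    qed
    then show ?thesis using that(1) by (simp add: field_simps)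
  qed
  have pscale: "p (r *\<^sub>R x) = r * p x" if "0 \<le> r" "0 \<le> x" for r x
  proof (cases "r = 0")
    case True
    have "p 0 \<le> 0" using pn[of 0] by simp
    then show ?thesis using p0[of 0] True by simp
  next
    case False
    then have r: "0 < r" using that by simp
    have "inverse r * p (r *\<^sub>R x) \<le> p (inverse r *\<^sub>R (r *\<^sub>R x))"
      using r that by (intro pscale_le) (auto intro: scaleR_nonneg_nonneg)
    then have "p (r *\<^sub>R x) \<le> r * p x" using r by (simp add: field_simps)
    then show ?thesis using pscale_le[OF r that(2)] by simp
  qed
  define q where "q x = p (pprt x) - p (pprt (- x))" for x
  have dec: "x = pprt x - pprt (- x)" for x :: 'a
    using prts[of x] by (simp add: pprt_neg)
  have qdiff: "q (a - b) = p a - p b" if ab: "0 \<le> a" "0 \<le> b" for a b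
  proof -
    have "pprt (a - b) + b = a + pprt (- (a - b))"
      using dec[of "a - b"] by (simp add: algebra_simps)
    then have "p (pprt (a - b)) + p b = p a + p (pprt (- (a - b)))"
      using ab padd[of "pprt (a - b)" b] padd[of a "pprt (- (a - b))"] by (metis zero_le_pprt)
    then show ?thesis by (simp add: q_def)
  qed
  have qpos: "q x = p x" if "0 \<le> x" for x
    using qdiff[OF that order_refl] p0[of 0] pn[of 0] by simp
  have qadd: "q (x + y) = q x + q y" for x y
  proof -
    have "x + y = (pprt x + pprt y) - (pprt (- x) + pprt (- y))"
      using dec[of x] dec[of y] by (metis add_diff_add)
    then have "q (x + y) = p (pprt x + pprt y) - p (pprt (- x) + pprt (- y))"
      using qdiff[of "pprt x + pprt y" "pprt (- x) + pprt (- y)"] by simp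
    then show ?thesis by (simp add: padd q_def)
  qed
  have qneg: "q (- x) = - q x" for x by (simp add: q_def)
  have qsc0: "q (r *\<^sub>R x) = r * q x" if "0 \<le> r" for r x
  proof -
    have "r *\<^sub>R x = r *\<^sub>R pprt x - r *\<^sub>R pprt (- x)"
      using dec[of x] by (metis scaleR_right_diff_distrib)
    then have "q (r *\<^sub>R x) = p (r *\<^sub>R pprt x) - p (r *\<^sub>R pprt (- x))"
      using qdiff[of "r *\<^sub>R pprt x" "r *\<^sub>R pprt (- x)"] that
      by (simp add: scaleR_nonneg_nonneg)
    then show ?thesis using that by (simp add: pscale q_def algebra_simps)
  qed
  have qsc: "q (r *\<^sub>R x) = r * q x" for r x
  proof (cases "0 \<le> r")
    case False
    then show ?thesis using qsc0[of "- r" x] qneg[of "r *\<^sub>R x"] by simp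
  qed (rule qsc0)
  have qbd: "norm (q x) \<le> norm x * norm f" for x
  proof -
    have n: "norm z \<le> norm x" if "0 \<le> z" "z \<le> \<bar>x\<bar>" for z
      using that by (intro norm_mono_abs) (simp add: abs_of_nonneg)
    have "norm (pprt x) \<le> norm x" "norm (pprt (- x)) \<le> norm x"
      by (rule n; simp add: pprt_def abs_ge_self abs_ge_minus_self)+
    then have "norm f * norm (pprt x) \<le> norm f * norm x"
      "norm f * norm (pprt (- x)) \<le> norm f * norm x"
      by (simp_all add: mult_left_mono)
    then show ?thesis
      using pn[of "pprt x"] pn[of "pprt (- x)"] p0[of "pprt x"] p0[of "pprt (- x)"]
      by (simp add: q_def abs_le_iff mult.commute)
  qed
  have bl: "bounded_linear q"
    by (rule bounded_linear_intro[where K = "norm f"]) (use qadd qsc qbd in simp_all)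
  define h where "h = Blinfun q"
  have h: "blinfun_apply h x = p x" if "0 \<le> x" for x
    using that bl by (simp add: h_def bounded_linear_Blinfun_apply qpos)
  show ?thesis
  proof (intro exI[of _ h] conjI allI impI)
    show "f \<le> h"
      using up by (auto simp: less_eq_blinfun_def h abs_of_nonneg)
    show "- f \<le> h"
    proof (unfold less_eq_blinfun_def, intro allI impI)
      fix x :: 'a assume "0 \<le> x"
      then show "blinfun_apply (- f) x \<le> blinfun_apply h x"
        using up[of "- x" x] by (simp add: h abs_of_nonneg blinfun.minus_left blinfun.minus_right)
    qed
    fix k assume k: "f \<le> k \<and> - f \<le> k"
    show "h \<le> k"
    proof (unfold less_eq_blinfun_def, intro allI impI)
      fix x :: 'a assume x: "0 \<le> x"
      have kpos: "0 \<le> blinfun_apply k z" if "0 \<le> z" for z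
        using k that by (fastforce simp: less_eq_blinfun_def blinfun.minus_left)
      have "p x \<le> blinfun_apply k x"
      proof (rule lub[OF x])
        fix y assume y: "\<bar>y\<bar> \<le> x"
        have yd: "y = pprt y - pprt (- y)" by (rule dec)
        have "blinfun_apply f y = blinfun_apply f (pprt y) + blinfun_apply (- f) (pprt (- y))"
          by (subst yd) (simp add: blinfun.diff_right blinfun.minus_left)
        also have "\<dots> \<le> blinfun_apply k (pprt y) + blinfun_apply k (pprt (- y))"
          using k by (intro add_mono) (auto simp: less_eq_blinfun_def)
        also have "\<dots> = blinfun_apply k \<bar>y\<bar>"
          by (simp add: abs_prts pprt_neg blinfun.diff_right blinfun.minus_right)
        also have "\<dots> \<le> blinfun_apply k x"
          using kpos[of "x - \<bar>y\<bar>"] y by (simp add: blinfun.diff_right)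
        finally show "blinfun_apply f y \<le> blinfun_apply k x" .
      qed
      then show "blinfun_apply h x \<le> blinfun_apply k x" using x by (simp add: h)
    qed
  qed
qed

lemma dual_abs_lub:
  fixes f :: "'a::banach_lattice \<Rightarrow>\<^sub>L real"
  shows "f \<le> dual_abs f" "- f \<le> dual_abs f"
    and "f \<le> k \<Longrightarrow> - f \<le> k \<Longrightarrow> dual_abs f \<le> k"
proof -
  obtain h where h: "f \<le> h" "- f \<le> h" "\<And>k. f \<le> k \<Longrightarrow> - f \<le> k \<Longrightarrow> h \<le> k"
    using dual_modulus_exists[of f] by blast
  then have "dual_abs f = h"
    unfolding dual_abs_def by (intro Least_equality) auto
  then show "f \<le> dual_abs f" "- f \<le> dual_abs f"
    "f \<le> k \<Longrightarrow> - f \<le> k \<Longrightarrow> dual_abs f \<le> k"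
    using h by simp_all
qed

lemma dual_inf_glb:
  fixes f g :: "'a::banach_lattice \<Rightarrow>\<^sub>L real"
  shows "dual_inf f g \<le> f" "dual_inf f g \<le> g"
    and "k \<le> f \<Longrightarrow> k \<le> g \<Longrightarrow> k \<le> dual_inf f g"
proof -
  define m where "m = (1/2) *\<^sub>R (f + g - dual_abs (f - g))"
  note * = less_eq_blinfun_def blinfun.add_left blinfun.diff_left blinfun.minus_left
    blinfun.scaleR_left
  have mf: "m \<le> f" "m \<le> g"
    using dual_abs_lub(1,2)[of "f - g"] by (auto simp: m_def * field_simps)
  have mk: "k \<le> m" if "k \<le> f" "k \<le> g" for k
  proof -
    have "dual_abs (f - g) \<le> f + g - 2 *\<^sub>R k"
      by (rule dual_abs_lub(3)) (use that in \<open>auto simp: * algebra_simps\<close>)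
    then show ?thesis by (auto simp: m_def * field_simps)
  qed
  have "dual_inf f g = m"
    unfolding dual_inf_def using mf mk by (intro Greatest_equality) auto
  then show "dual_inf f g \<le> f" "dual_inf f g \<le> g"
    "k \<le> f \<Longrightarrow> k \<le> g \<Longrightarrow> k \<le> dual_inf f g"
    using mf mk by simp_all
qed

definition disjoint_dual_seq :: "(nat \<Rightarrow> ('a::banach_lattice \<Rightarrow>\<^sub>L real)) \<Rightarrow> bool" where
  "disjoint_dual_seq f \<longleftrightarrow>
    (\<forall>m n. m \<noteq> n \<longrightarrow> dual_inf (dual_abs (f m)) (dual_abs (f n)) = 0)"

text \<open>On the function type, \<^const>\<open>euclidean\<close> is the product topology.\<close>

definition weak_star_topology :: "('a::real_normed_vector \<Rightarrow>\<^sub>L real) topology" where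
  "weak_star_topology = pullback_topology UNIV blinfun_apply euclidean"

definition weak_star_null :: "(nat \<Rightarrow> ('a::real_normed_vector \<Rightarrow>\<^sub>L real)) \<Rightarrow> bool" where
  "weak_star_null f \<longleftrightarrow> limitin weak_star_topology f 0 sequentially"

lemma weak_star_null_iff:
  "weak_star_null f \<longleftrightarrow> (\<forall>x. (\<lambda>n. blinfun_apply (f n) x) \<longlonglongrightarrow> 0)"
proof -
  have op: "openin weak_star_topology U \<longleftrightarrow> (\<exists>V. open V \<and> U = blinfun_apply -` V)"
    for U :: "('a \<Rightarrow>\<^sub>L real) set"
    by (simp add: weak_star_topology_def openin_pullback_topology)
  have top: "topspace (weak_star_topology :: ('a \<Rightarrow>\<^sub>L real) topology) = UNIV"
    by (simp add: weak_star_topology_def topspace_pullback_topology)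
  have "weak_star_null f \<longleftrightarrow>
      (\<forall>V. open V \<longrightarrow> blinfun_apply 0 \<in> V \<longrightarrow>
        (\<forall>\<^sub>F n in sequentially. blinfun_apply (f n) \<in> V))"
    unfolding weak_star_null_def limitin_def op top by auto
  also have "\<dots> \<longleftrightarrow>
      limitin euclidean (\<lambda>n. blinfun_apply (f n)) (blinfun_apply 0) sequentially"
    by (auto simp: limitin_def)
  also have "\<dots> \<longleftrightarrow> (\<forall>x. (\<lambda>n. blinfun_apply (f n) x) \<longlonglongrightarrow> 0)"
    by (simp add: limitin_componentwise blinfun.zero_left flip: euclidean_product_topology)
  finally show ?thesis .
qed

section \<open>Property (d), almost limited sets, solid sets\<close>

definition property_d :: "'a::banach_lattice itself \<Rightarrow> bool" where
  "property_d _ \<longleftrightarrow>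
    (\<forall>f :: nat \<Rightarrow> ('a \<Rightarrow>\<^sub>L real).
      disjoint_dual_seq f \<longrightarrow> weak_star_null f \<longrightarrow> weak_star_null (\<lambda>n. dual_abs (f n)))"

definition almost_limited :: "'a::banach_lattice set \<Rightarrow> bool" where
  "almost_limited A \<longleftrightarrow> bounded A \<and>
    (\<forall>f :: nat \<Rightarrow> ('a \<Rightarrow>\<^sub>L real).
      disjoint_dual_seq f \<longrightarrow> weak_star_null f \<longrightarrow>
        uniform_limit A (\<lambda>n. blinfun_apply (f n)) (\<lambda>_. 0) sequentially)"

definition solid :: "'a::banach_lattice set \<Rightarrow> bool" where
  "solid S \<longleftrightarrow> (\<forall>x\<in>S. \<forall>y. \<bar>y\<bar> \<le> \<bar>x\<bar> \<longrightarrow> y \<in> S)"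

end

theory Submission
  imports Defs
begin

text \<open>The implication from (1) to (3) rests on the identity
  \<open>|f| |x| = max {g x | |g| \<le> |f|}\<close>: if \<open>(f\<^sub>n)\<close> is a disjoint weak* null sequence, choose
  \<open>g\<^sub>n\<close> with \<open>|g\<^sub>n| \<le> |f\<^sub>n|\<close> that attains \<open>|f\<^sub>n| |x\<^sub>n|\<close> at a point \<open>x\<^sub>n \<in> A\<close> where this value is
  large. Then \<open>(g\<^sub>n)\<close> is disjoint and, by property (d), weak* null, so it tends to zero uniformly
  on \<open>A\<close>. The maximiser is \<open>2g - |f|\<close>, where \<open>g y = sup\<^sub>t |f| (y \<and> t x\<^sup>+)\<close> for \<open>y \<ge> 0\<close> is the
  component of \<open>|f|\<close> carried by \<open>x\<^sup>+\<close>. That (2) implies (1) is the Riesz--Kantorovich formula for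
  \<open>|f|\<close> on the order intervals \<open>[-x, x]\<close>, and (3) implies (2) because an order interval lies in
  the solid hull of a singleton.\<close>

section \<open>Functionals on a Banach lattice\<close>

lemma pprt_minus_pprt_uminus: "pprt x - pprt (- x) = x" for x :: "'a::lattice_ab_group_add"
  using prts[of x] by (simp add: pprt_neg)

lemma pprt_plus_pprt_uminus: "pprt x + pprt (- x) = \<bar>x\<bar>" for x :: "'a::lattice_ab_group_add_abs"
  by (simp add: abs_prts pprt_neg)

lemma norm_abs_lattice: "norm \<bar>x\<bar> = norm x" for x :: "'a::banach_lattice"
  by (intro antisym norm_mono_abs) simp_all

lemma inf_scaleR_le:
  fixes x y :: "'a::banach_lattice"
  assumes "0 < r"
  shows "inf (r *\<^sub>R x) (r *\<^sub>R y) \<le> r *\<^sub>R inf x y"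
proof -
  let ?z = "inf (r *\<^sub>R x) (r *\<^sub>R y)"
  have "inverse r *\<^sub>R ?z \<le> inverse r *\<^sub>R (r *\<^sub>R x)" "inverse r *\<^sub>R ?z \<le> inverse r *\<^sub>R (r *\<^sub>R y)"
    using assms by (intro scaleR_left_mono; simp)+
  then have "inverse r *\<^sub>R ?z \<le> inf x y" using assms by simp
  then have "r *\<^sub>R (inverse r *\<^sub>R ?z) \<le> r *\<^sub>R inf x y"
    using assms by (intro scaleR_left_mono) simp_all
  then show ?thesis using assms by simp
qed

text \<open>The right-hand side is the infimum of \<open>a + b\<close>, \<open>c + b\<close>,
  \<open>a + c\<close> and \<open>c + c\<close>; by positivity each of these dominates
  \<open>a + b\<close> or \<open>c\<close>.\<close>

lemma inf_add_le_add_inf: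
  fixes a b c :: "'a::lattice_ab_group_add"
  assumes "0 \<le> a" "0 \<le> b" "0 \<le> c"
  shows "inf (a + b) c \<le> inf a c + inf b c"
proof -
  have "inf (a + b) c \<le> inf (inf (a + b) (c + b)) (inf (a + c) (c + c))"
    using assms by (auto intro: le_infI1 le_infI2 add_increasing add_increasing2)
  also have "\<dots> = inf a c + inf b c"
    by (simp only: add_inf_distrib_left add_inf_distrib_right)
  finally show ?thesis .
qed

text \<open>Kantorovich extension: set \<open>p\<close> of the positive part minus \<open>p\<close>
  of the negative part. One inequality for scaling suffices, since applying it to
  \<open>inverse r\<close> gives the reverse one.\<close>

lemma positive_cone_extension:
  fixes p :: "'a::banach_lattice \<Rightarrow> real"
  assumes nonneg: "\<And>x. 0 \<le> x \<Longrightarrow> 0 \<le> p x"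
    and bound: "\<And>x. 0 \<le> x \<Longrightarrow> p x \<le> C * norm x"
    and add: "\<And>x y. 0 \<le> x \<Longrightarrow> 0 \<le> y \<Longrightarrow> p (x + y) = p x + p y"
    and scale_le: "\<And>r x. 0 < r \<Longrightarrow> 0 \<le> x \<Longrightarrow> p (r *\<^sub>R x) \<le> r * p x"
  obtains g :: "'a \<Rightarrow>\<^sub>L real" where "\<And>x. 0 \<le> x \<Longrightarrow> blinfun_apply g x = p x"
proof -
  have p0: "p 0 = 0"
    using add[of 0 0] by simp
  have scale: "p (r *\<^sub>R x) = r * p x" if "0 \<le> r" "0 \<le> x" for r x
  proof (cases "r = 0")
    case True
    then show ?thesis by (simp add: p0)
  next
    case False
    then have r: "0 < r" using that by simp
    have "p (inverse r *\<^sub>R (r *\<^sub>R x)) \<le> inverse r * p (r *\<^sub>R x)"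
      using r that by (intro scale_le scaleR_nonneg_nonneg) auto
    then have "r * p x \<le> p (r *\<^sub>R x)" using r by (simp add: field_simps)
    then show ?thesis using scale_le[OF r that(2)] by simp
  qed
  define q where "q x = p (pprt x) - p (pprt (- x))" for x
  \<comment> \<open>By additivity of \<open>p\<close>, every representation of a vector as a
    difference of positive vectors gives the same value. This makes \<open>q\<close> additive
    although \<open>pprt\<close> is not.\<close>
  have qdiff: "q (a - b) = p a - p b" if ab: "0 \<le> a" "0 \<le> b" for a b
  proof -
    have "pprt (a - b) + b = a + pprt (- (a - b))"
      using pprt_minus_pprt_uminus[of "a - b"] by (simp add: algebra_simps)
    then have "p (pprt (a - b)) + p b = p a + p (pprt (- (a - b)))"
      using ab add[of "pprt (a - b)" b] add[of a "pprt (- (a - b))"] by (metis zero_le_pprt)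
    then show ?thesis by (simp add: q_def)
  qed
  have qpos: "q x = p x" if "0 \<le> x" for x
    using qdiff[OF that order_refl] p0 by simp
  have qadd: "q (x + y) = q x + q y" for x y
  proof -
    have "x + y = (pprt x + pprt y) - (pprt (- x) + pprt (- y))"
      by (metis add_diff_add pprt_minus_pprt_uminus)
    then have "q (x + y) = p (pprt x + pprt y) - p (pprt (- x) + pprt (- y))"
      using qdiff[of "pprt x + pprt y" "pprt (- x) + pprt (- y)"] by simp
    then show ?thesis by (simp add: add q_def)
  qed
  have qsc0: "q (r *\<^sub>R x) = r * q x" if "0 \<le> r" for r x
  proof -
    have "r *\<^sub>R x = r *\<^sub>R pprt x - r *\<^sub>R pprt (- x)"
      by (metis pprt_minus_pprt_uminus scaleR_right_diff_distrib)
    then have "q (r *\<^sub>R x) = p (r *\<^sub>R pprt x) - p (r *\<^sub>R pprt (- x))"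
      using qdiff[of "r *\<^sub>R pprt x" "r *\<^sub>R pprt (- x)"] that
      by (simp add: scaleR_nonneg_nonneg)
    then show ?thesis using that by (simp add: scale q_def algebra_simps)
  qed
  have qsc: "q (r *\<^sub>R x) = r * q x" for r x
  proof (cases "0 \<le> r")
    case False
    have "q (- (r *\<^sub>R x)) = - q (r *\<^sub>R x)" by (simp add: q_def)
    then show ?thesis using qsc0[of "- r" x] False by simp
  qed (rule qsc0)
  have qbd: "norm (q x) \<le> norm x * C" for x
  proof -
    have "p (pprt x) + p (pprt (- x)) = p \<bar>x\<bar>"
      by (simp add: add flip: pprt_plus_pprt_uminus)
    also have "\<dots> \<le> C * norm x"
      using bound[of "\<bar>x\<bar>"] by (simp add: norm_abs_lattice)
    finally show ?thesis
      using nonneg[of "pprt x"] nonneg[of "pprt (- x)"]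
      by (simp add: q_def abs_le_iff mult.commute)
  qed
  have "bounded_linear q"
    by (rule bounded_linear_intro[where K = C]) (use qadd qsc qbd in simp_all)
  then show ?thesis
    by (intro that[of "Blinfun q"]) (simp add: bounded_linear_Blinfun_apply qpos)
qed

section \<open>The modulus of a functional and the Riesz--Kantorovich formula\<close>

lemma dual_abs_nonneg:
  fixes f :: "'a::banach_lattice \<Rightarrow>\<^sub>L real"
  assumes "0 \<le> x"
  shows "0 \<le> blinfun_apply (dual_abs f) x"
  using dual_abs_lub(1,2)[of f] assms
  by (fastforce simp: less_eq_blinfun_def blinfun.minus_left)

lemma dual_abs_mono:
  fixes f :: "'a::banach_lattice \<Rightarrow>\<^sub>L real"
  assumes "0 \<le> x" "x \<le> y"
  shows "blinfun_apply (dual_abs f) x \<le> blinfun_apply (dual_abs f) y"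
  using dual_abs_nonneg[of "y - x" f] assms by (simp add: blinfun.diff_right)

text \<open>Any majorant \<open>h\<close> of \<open>f\<close> and \<open>- f\<close> is allowed, so
  that \<open>h\<close> can also be the modulus of another functional that dominates
  \<open>f\<close>.\<close>

lemma abs_apply_le:
  fixes f h :: "'a::banach_lattice \<Rightarrow>\<^sub>L real"
  assumes "f \<le> h" "- f \<le> h"
  shows "\<bar>blinfun_apply f x\<bar> \<le> blinfun_apply h \<bar>x\<bar>"
proof -
  have *: "\<bar>blinfun_apply f z\<bar> \<le> blinfun_apply h z" if "0 \<le> z" for z
    using assms that by (fastforce simp: less_eq_blinfun_def blinfun.minus_left)
  have "blinfun_apply f x = blinfun_apply f (pprt x) - blinfun_apply f (pprt (- x))"
    by (metis pprt_minus_pprt_uminus blinfun.diff_right)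
  also have "\<bar>\<dots>\<bar> \<le> blinfun_apply h (pprt x) + blinfun_apply h (pprt (- x))"
    using *[of "pprt x"] *[of "pprt (- x)"] by simp
  also have "\<dots> = blinfun_apply h \<bar>x\<bar>"
    by (simp flip: blinfun.add_right add: pprt_plus_pprt_uminus)
  finally show ?thesis .
qed

lemmas abs_apply_le_dual_abs = abs_apply_le[OF dual_abs_lub(1,2)]

text \<open>The nontrivial half of the Riesz--Kantorovich formula. The supremum of \<open>f\<close>
  over \<open>[-x, x]\<close> is additive in \<open>x \<ge> 0\<close>, so it extends to a functional
  that majorises \<open>f\<close> and \<open>- f\<close>; the modulus, being the least such, lies
  below it.\<close>

lemma dual_abs_apply_le:
  fixes f :: "'a::banach_lattice \<Rightarrow>\<^sub>L real"
  assumes "0 \<le> x" and le_c: "\<And>y. \<bar>y\<bar> \<le> x \<Longrightarrow> blinfun_apply f y \<le> c"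
  shows "blinfun_apply (dual_abs f) x \<le> c"
proof -
  define p where "p x = (SUP y\<in>{y. \<bar>y\<bar> \<le> x}. blinfun_apply f y)" for x :: 'a
  \<comment> \<open>The modulus, already known to exist, makes the supremum finite and later
    supplies its norm bound.\<close>
  have bnd: "blinfun_apply f y \<le> blinfun_apply (dual_abs f) x" if "\<bar>y\<bar> \<le> x" for x y
    using abs_apply_le_dual_abs[of f y] dual_abs_mono[of "\<bar>y\<bar>" x f] that by simp
  have bdd: "bdd_above (blinfun_apply f ` {y. \<bar>y\<bar> \<le> x})" for x
    using bnd by (auto simp: bdd_above_def)
  have up: "blinfun_apply f y \<le> p x" if "\<bar>y\<bar> \<le> x" for x y
    unfolding p_def using that by (intro cSUP_upper bdd) auto
  have lub: "p x \<le> c" if "0 \<le> x" "\<And>y. \<bar>y\<bar> \<le> x \<Longrightarrow> blinfun_apply f y \<le> c" for x c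
    unfolding p_def using that by (intro cSUP_least) (auto intro!: exI[of _ 0])
  have p_nonneg: "0 \<le> p x" if "0 \<le> x" for x
    using up[of 0 x] that by (simp add: blinfun.zero_right)
  have p_bound: "p x \<le> norm (dual_abs f) * norm x" if "0 \<le> x" for x
  proof -
    have "p x \<le> blinfun_apply (dual_abs f) x" using that bnd by (rule lub)
    then show ?thesis using norm_blinfun[of "dual_abs f" x] by simp
  qed
  have p_add: "p (a + b) = p a + p b" if ab: "0 \<le> a" "0 \<le> b" for a b
  proof (rule antisym)
    show "p (a + b) \<le> p a + p b"
    proof (rule lub)
      fix y assume "\<bar>y\<bar> \<le> a + b"
      \<comment> \<open>Riesz decomposition of \<open>y\<close>.\<close>
      then obtain u v where "y = u + v" "\<bar>u\<bar> \<le> a" "\<bar>v\<bar> \<le> b"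
        using ab by (rule abs_le_sum_split)
      then show "blinfun_apply f y \<le> p a + p b"
        using up[of u a] up[of v b] by (simp add: blinfun.add_right)
    qed (use ab in simp)
    \<comment> \<open>Superadditivity: take the supremum over \<open>u\<close> and over
      \<open>v\<close> one after the other.\<close>
    have "p a \<le> p (a + b) - p b"
    proof (rule lub[OF ab(1)])
      fix u assume u: "\<bar>u\<bar> \<le> a"
      have "p b \<le> p (a + b) - blinfun_apply f u"
      proof (rule lub[OF ab(2)])
        fix v assume v: "\<bar>v\<bar> \<le> b"
        have "\<bar>u + v\<bar> \<le> a + b"
          using abs_triangle_ineq[of u v] add_mono[OF u v] by (rule order_trans)
        from up[OF this] show "blinfun_apply f v \<le> p (a + b) - blinfun_apply f u"
          by (simp add: blinfun.add_right)
      qed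
      then show "blinfun_apply f u \<le> p (a + b) - p b" by simp
    qed
    then show "p a + p b \<le> p (a + b)" by simp
  qed
  have p_scale: "p (r *\<^sub>R x) \<le> r * p x" if "0 < r" "0 \<le> x" for r x
  proof (rule lub)
    fix y assume "\<bar>y\<bar> \<le> r *\<^sub>R x"
    then have "inverse r *\<^sub>R y \<le> inverse r *\<^sub>R (r *\<^sub>R x)"
      "inverse r *\<^sub>R (- y) \<le> inverse r *\<^sub>R (r *\<^sub>R x)"
      using that(1) by (intro scaleR_left_mono; simp add: abs_le_iff)+
    then have "\<bar>inverse r *\<^sub>R y\<bar> \<le> x" using that(1) by (simp add: abs_le_iff)
    from up[OF this] show "blinfun_apply f y \<le> r * p x"
      using that(1) by (simp add: blinfun.scaleR_right field_simps)
  qed (use that in \<open>simp add: scaleR_nonneg_nonneg\<close>)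
  obtain h where h: "\<And>x. 0 \<le> x \<Longrightarrow> blinfun_apply h x = p x"
    using positive_cone_extension[OF p_nonneg p_bound p_add p_scale] by blast
  have "f \<le> h" "- f \<le> h"
    using up[of x x for x] up[of "- x" x for x]
    by (auto simp: less_eq_blinfun_def h abs_of_nonneg blinfun.minus_left blinfun.minus_right)
  then have "dual_abs f \<le> h" by (rule dual_abs_lub(3))
  then have "blinfun_apply (dual_abs f) x \<le> p x"
    using \<open>0 \<le> x\<close> h by (simp add: less_eq_blinfun_def)
  also have "\<dots> \<le> c" using assms by (rule lub)
  finally show ?thesis .
qed

section \<open>Components of a positive functional and norming functionals\<close>

text \<open>On positive \<open>x\<close>, \<open>g\<close> is the supremum of
  \<open>f (inf x (t *\<^sub>R u))\<close> over \<open>t \<ge> 0\<close>. At \<open>u\<close> the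
  value \<open>f u\<close> is reached with \<open>t = 1\<close>; a vector disjoint from
  \<open>u\<close> is disjoint from all its multiples, so \<open>g\<close> vanishes there.\<close>

lemma positive_functional_component:
  fixes f :: "'a::banach_lattice \<Rightarrow>\<^sub>L real"
  assumes f: "0 \<le> f" and u: "0 \<le> u"
  obtains g where "0 \<le> g" "g \<le> f" "blinfun_apply g u = blinfun_apply f u"
    "\<And>v. inf u v = 0 \<Longrightarrow> blinfun_apply g v = 0"
proof -
  have fpos: "0 \<le> blinfun_apply f x" if "0 \<le> x" for x
    using f that by (simp add: less_eq_blinfun_def blinfun.zero_left)
  have fmono: "blinfun_apply f x \<le> blinfun_apply f y" if "x \<le> y" for x y
    using fpos[of "y - x"] that by (simp add: blinfun.diff_right)
  have tu: "0 \<le> t *\<^sub>R u" if "0 \<le> t" for t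
    using that u by (rule scaleR_nonneg_nonneg)
  define p where "p x = (SUP t\<in>{0..}. blinfun_apply f (inf x (t *\<^sub>R u)))" for x
  have bdd: "bdd_above ((\<lambda>t. blinfun_apply f (inf x (t *\<^sub>R u))) ` {0..})" for x
    by (rule bdd_aboveI2[of _ _ "blinfun_apply f x"]) (simp add: fmono)
  have up: "blinfun_apply f (inf x (t *\<^sub>R u)) \<le> p x" if "0 \<le> t" for t x
    unfolding p_def using that by (intro cSUP_upper bdd) auto
  have lub: "p x \<le> c" if "\<And>t. 0 \<le> t \<Longrightarrow> blinfun_apply f (inf x (t *\<^sub>R u)) \<le> c" for x c
    unfolding p_def using that by (intro cSUP_least) auto
  have p_nonneg: "0 \<le> p x" if "0 \<le> x" for x
    using up[of 0 x] that by (simp add: inf_absorb2 blinfun.zero_right)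
  have p_le: "p x \<le> blinfun_apply f x" for x
    by (rule lub) (simp add: fmono)
  have p_bound: "p x \<le> norm f * norm x" for x
    using p_le[of x] norm_blinfun[of f x] by simp
  have p_add: "p (a + b) = p a + p b" if ab: "0 \<le> a" "0 \<le> b" for a b
  proof (rule antisym)
    show "p (a + b) \<le> p a + p b"
    proof (rule lub)
      fix t :: real assume t: "0 \<le> t"
      have "blinfun_apply f (inf (a + b) (t *\<^sub>R u))
          \<le> blinfun_apply f (inf a (t *\<^sub>R u) + inf b (t *\<^sub>R u))"
        by (intro fmono inf_add_le_add_inf ab tu t)
      also have "\<dots> \<le> p a + p b"
        using up[OF t, of a] up[OF t, of b] by (simp add: blinfun.add_right)
      finally show "blinfun_apply f (inf (a + b) (t *\<^sub>R u)) \<le> p a + p b" .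
    qed
    have "p a \<le> p (a + b) - p b"
    proof (rule lub)
      fix s :: real assume s: "0 \<le> s"
      have "p b \<le> p (a + b) - blinfun_apply f (inf a (s *\<^sub>R u))"
      proof (rule lub)
        fix t :: real assume t: "0 \<le> t"
        \<comment> \<open>Different multiples of \<open>u\<close> for \<open>a\<close> and
          \<open>b\<close> are absorbed by the single multiple \<open>s + t\<close>, which yields
          superadditivity.\<close>
        have "inf a (s *\<^sub>R u) + inf b (t *\<^sub>R u) \<le> inf (a + b) ((s + t) *\<^sub>R u)"
          by (simp add: scaleR_add_left add_mono)
        then have "blinfun_apply f (inf a (s *\<^sub>R u) + inf b (t *\<^sub>R u))
            \<le> blinfun_apply f (inf (a + b) ((s + t) *\<^sub>R u))"
          by (rule fmono)
        also have "\<dots> \<le> p (a + b)" using s t by (intro up) simp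
        finally show "blinfun_apply f (inf b (t *\<^sub>R u))
            \<le> p (a + b) - blinfun_apply f (inf a (s *\<^sub>R u))"
          by (simp add: blinfun.add_right)
      qed
      then show "blinfun_apply f (inf a (s *\<^sub>R u)) \<le> p (a + b) - p b" by simp
    qed
    then show "p a + p b \<le> p (a + b)" by simp
  qed
  have p_scale: "p (r *\<^sub>R x) \<le> r * p x" if r: "0 < r" for r x
  proof (rule lub)
    fix t :: real assume t: "0 \<le> t"
    have "inf (r *\<^sub>R x) (t *\<^sub>R u) = inf (r *\<^sub>R x) (r *\<^sub>R ((t / r) *\<^sub>R u))"
      using r by simp
    also have "\<dots> \<le> r *\<^sub>R inf x ((t / r) *\<^sub>R u)"
      using r by (rule inf_scaleR_le)
    finally have "blinfun_apply f (inf (r *\<^sub>R x) (t *\<^sub>R u))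
        \<le> blinfun_apply f (r *\<^sub>R inf x ((t / r) *\<^sub>R u))"
      by (rule fmono)
    also have "\<dots> \<le> r * p x"
      using up[of "t / r" x] r t by (simp add: blinfun.scaleR_right)
    finally show "blinfun_apply f (inf (r *\<^sub>R x) (t *\<^sub>R u)) \<le> r * p x" .
  qed
  obtain g where g: "\<And>x. 0 \<le> x \<Longrightarrow> blinfun_apply g x = p x"
    using positive_cone_extension[OF p_nonneg p_bound p_add p_scale] by blast
  show ?thesis
  proof
    show "0 \<le> g" by (simp add: less_eq_blinfun_def blinfun.zero_left g p_nonneg)
    show "g \<le> f" by (simp add: less_eq_blinfun_def g p_le)
    show "blinfun_apply g u = blinfun_apply f u"
      using up[of 1 u] p_le[of u] u by (simp add: g)
    show "blinfun_apply g v = 0" if uv: "inf u v = 0" for v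
    proof -
      have v: "0 \<le> v" using uv by (metis inf_le2)
      have "p v \<le> 0"
      proof (rule lub)
        fix t :: real assume t: "0 \<le> t"
        \<comment> \<open>A common factor \<open>r\<close> dominates the coefficients of both
          \<open>v\<close> and \<open>t *\<^sub>R u\<close>, so it can be pulled out of the
          infimum.\<close>
        define r where "r = max t 1"
        have r: "0 < r" "t \<le> r" "1 \<le> r" by (auto simp: r_def)
        have "v \<le> r *\<^sub>R v" using scaleR_right_mono[OF r(3) v] by simp
        then have "inf v (t *\<^sub>R u) \<le> inf (r *\<^sub>R v) (r *\<^sub>R u)"
          using scaleR_right_mono[OF r(2) u] by (rule inf_mono)
        also have "\<dots> \<le> r *\<^sub>R inf v u" using r(1) by (rule inf_scaleR_le)
        also have "\<dots> = 0" using uv by (simp add: inf_commute)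
        finally show "blinfun_apply f (inf v (t *\<^sub>R u)) \<le> 0"
          using fmono blinfun.zero_right by metis
      qed
      then show ?thesis using p_nonneg[OF v] by (simp add: g v)
    qed
  qed
qed

text \<open>Take the component \<open>g\<close> of \<open>dual_abs f\<close> carried by the positive
  part of \<open>x\<close>. Then \<open>2 *\<^sub>R g - dual_abs f\<close> agrees with
  \<open>dual_abs f\<close> on the positive part and with its negative on the negative part, and
  \<open>0 \<le> g \<le> dual_abs f\<close> bounds its modulus.\<close>

lemma dual_abs_attained:
  fixes f :: "'a::banach_lattice \<Rightarrow>\<^sub>L real"
  shows "\<exists>g. dual_abs g \<le> dual_abs f \<and> blinfun_apply g x = blinfun_apply (dual_abs f) \<bar>x\<bar>"
proof -
  have disj: "inf (pprt x) (pprt (- x)) = 0"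
  proof -
    \<comment> \<open>Translating by the negative part reduces the infimum to
      \<open>inf x 0\<close>, the negative of that part.\<close>
    have "inf (pprt x) (pprt (- x)) = pprt (- x) + inf (pprt x - pprt (- x)) 0"
      by (simp add: add_inf_distrib_left)
    also have "\<dots> = pprt (- x) + inf x 0"
      by (simp only: pprt_minus_pprt_uminus)
    also have "\<dots> = 0"
      by (simp only: pprt_neg nprt_def left_minus)
    finally show ?thesis .
  qed
  have "0 \<le> dual_abs f"
    by (simp add: less_eq_blinfun_def blinfun.zero_left dual_abs_nonneg)
  then obtain g where g: "0 \<le> g" "g \<le> dual_abs f"
      "blinfun_apply g (pprt x) = blinfun_apply (dual_abs f) (pprt x)"
      "blinfun_apply g (pprt (- x)) = 0"
    using positive_functional_component[of "dual_abs f" "pprt x"] disj by (metis zero_le_pprt)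
  have "dual_abs (2 *\<^sub>R g - dual_abs f) \<le> dual_abs f"
    using g(1,2) by (intro dual_abs_lub(3))
      (auto simp: less_eq_blinfun_def blinfun.zero_left blinfun.minus_left blinfun.diff_left
        blinfun.scaleR_left)
  moreover have "blinfun_apply (2 *\<^sub>R g - dual_abs f) x = blinfun_apply (dual_abs f) \<bar>x\<bar>"
  proof -
    have "blinfun_apply h x = blinfun_apply h (pprt x) - blinfun_apply h (pprt (- x))"
      "blinfun_apply h \<bar>x\<bar> = blinfun_apply h (pprt x) + blinfun_apply h (pprt (- x))"
      for h :: "'a \<Rightarrow>\<^sub>L real"
      by (simp_all flip: blinfun.diff_right blinfun.add_right
          add: pprt_minus_pprt_uminus pprt_plus_pprt_uminus)
    note this[of g] this[of "dual_abs f"]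
    then show ?thesis
      using g(3,4) by (simp add: blinfun.diff_left blinfun.scaleR_left)
  qed
  ultimately show ?thesis by blast
qed

text \<open>Transfers disjointness to the norming functionals, by monotonicity of the meet.\<close>

lemma disjoint_dual_seq_dominated:
  fixes f g :: "nat \<Rightarrow> ('a::banach_lattice \<Rightarrow>\<^sub>L real)"
  assumes "disjoint_dual_seq f" and le: "\<And>n. dual_abs (g n) \<le> dual_abs (f n)"
  shows "disjoint_dual_seq g"
  unfolding disjoint_dual_seq_def
proof (intro allI impI antisym)
  fix m n :: nat assume "m \<noteq> n"
  then have "dual_inf (dual_abs (f m)) (dual_abs (f n)) = 0"
    using assms(1) by (simp add: disjoint_dual_seq_def)
  moreover have "dual_inf (dual_abs (g m)) (dual_abs (g n))
      \<le> dual_inf (dual_abs (f m)) (dual_abs (f n))"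
    by (intro dual_inf_glb(3) order_trans[OF dual_inf_glb(1) le] order_trans[OF dual_inf_glb(2) le])
  ultimately show "dual_inf (dual_abs (g m)) (dual_abs (g n)) \<le> 0" by simp
  show "0 \<le> dual_inf (dual_abs (g m)) (dual_abs (g n))"
    by (rule dual_inf_glb(3))
      (simp_all add: less_eq_blinfun_def blinfun.zero_left dual_abs_nonneg)
qed

section \<open>Almost limited sets\<close>

lemma solid_hull_eq: "solid hull A = {y. \<exists>x\<in>A. \<bar>y\<bar> \<le> \<bar>x\<bar>}"
proof (rule hull_unique)
  show "A \<subseteq> {y. \<exists>x\<in>A. \<bar>y\<bar> \<le> \<bar>x\<bar>}" by blast
  show "solid {y. \<exists>x\<in>A. \<bar>y\<bar> \<le> \<bar>x\<bar>}"
    unfolding solid_def by (blast intro: order_trans)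
  show "{y. \<exists>x\<in>A. \<bar>y\<bar> \<le> \<bar>x\<bar>} \<subseteq> T" if "A \<subseteq> T" "solid T" for T
    using that unfolding solid_def by blast
qed

lemma bounded_solid_hull: "bounded A \<Longrightarrow> bounded (solid hull A)"
  unfolding bounded_iff solid_hull_eq by (blast intro: norm_mono_abs order_trans)

lemma almost_limited_subset: "almost_limited B \<Longrightarrow> A \<subseteq> B \<Longrightarrow> almost_limited A"
  unfolding almost_limited_def by (meson bounded_subset uniform_limit_on_subset)

text \<open>On one point uniform convergence is pointwise convergence. Together with the next
  inclusion this takes (3) to (2).\<close>

lemma almost_limited_singleton: "almost_limited {x}"
  by (auto simp: almost_limited_def weak_star_null_iff uniform_limit_iff tendsto_iff)

lemma atLeastAtMost_subset_solid_hull: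
  fixes a b :: "'a::banach_lattice"
  shows "{a..b} \<subseteq> solid hull {\<bar>a\<bar> + \<bar>b\<bar>}"
proof
  fix x assume "x \<in> {a..b}"
  then have "x \<le> \<bar>b\<bar>" "- x \<le> \<bar>a\<bar>"
    using abs_ge_self[of b] abs_ge_minus_self[of a] 
    by (auto intro: order_trans[of "- x" "- a"] order_trans[of x b])
  then have "\<bar>x\<bar> \<le> \<bar>a\<bar> + \<bar>b\<bar>"
    by (simp add: abs_le_iff add_increasing add_increasing2)
  then show "x \<in> solid hull {\<bar>a\<bar> + \<bar>b\<bar>}"
    by (simp add: solid_hull_eq)
qed

section \<open>The implications between the three assertions\<close>

lemma almost_limited_solid_hull:
  fixes A :: "'a::banach_lattice set"
  assumes d: "property_d TYPE('a)" and A: "almost_limited A"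
  shows "almost_limited (solid hull A)"
  unfolding almost_limited_def
proof (intro conjI allI impI)
  show "bounded (solid hull A)"
    using A by (simp add: almost_limited_def bounded_solid_hull)
  fix f :: "nat \<Rightarrow> ('a \<Rightarrow>\<^sub>L real)"
  assume f: "disjoint_dual_seq f" "weak_star_null f"
  have abs_null: "(\<lambda>n. blinfun_apply (dual_abs (f n)) x) \<longlonglongrightarrow> 0" for x
    using d f by (simp add: property_d_def weak_star_null_iff)
  show "uniform_limit (solid hull A) (\<lambda>n. blinfun_apply (f n)) (\<lambda>_. 0) sequentially"
    unfolding uniform_limit_iff
  proof (intro allI impI)
    fix e :: real assume "0 < e"
    \<comment> \<open>\<open>x n\<close> witnesses that the modulus of \<open>f n\<close> reaches
      \<open>e\<close> somewhere on the moduli of points of \<open>A\<close>; if it never does,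
      \<open>x n\<close> is arbitrary and may lie outside \<open>A\<close>.\<close>
    have "\<forall>n. \<exists>x. \<forall>z\<in>A. e \<le> blinfun_apply (dual_abs (f n)) \<bar>z\<bar> \<longrightarrow>
        x \<in> A \<and> e \<le> blinfun_apply (dual_abs (f n)) \<bar>x\<bar>"
      by blast
    from choice[OF this] obtain x where x: "\<And>n z. z \<in> A \<Longrightarrow> e \<le> blinfun_apply (dual_abs (f n)) \<bar>z\<bar> \<Longrightarrow>
        x n \<in> A \<and> e \<le> blinfun_apply (dual_abs (f n)) \<bar>x n\<bar>"
      by blast
    have "\<forall>n. \<exists>h. dual_abs h \<le> dual_abs (f n) \<and>
        blinfun_apply h (x n) = blinfun_apply (dual_abs (f n)) \<bar>x n\<bar>"
      by (intro allI dual_abs_attained)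
    from choice[OF this] obtain g where g: "\<And>n. dual_abs (g n) \<le> dual_abs (f n)"
        "\<And>n. blinfun_apply (g n) (x n) = blinfun_apply (dual_abs (f n)) \<bar>x n\<bar>"
      by blast
    have "disjoint_dual_seq g"
      using f(1) g(1) by (rule disjoint_dual_seq_dominated)
    moreover have "weak_star_null g"
      unfolding weak_star_null_iff
    proof
      fix y
      \<comment> \<open>Property (d) enters here, through the convergence of the right-hand side to
        zero.\<close>
      have "\<bar>blinfun_apply (g n) y\<bar> \<le> blinfun_apply (dual_abs (f n)) \<bar>y\<bar>" for n
        using g(1)[of n] dual_abs_lub(1,2)[of "g n"] by (intro abs_apply_le) simp_all
      then show "(\<lambda>n. blinfun_apply (g n) y) \<longlonglongrightarrow> 0"
        by (intro Lim_null_comparison[OF _ abs_null[of "\<bar>y\<bar>"]]) simp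
    qed
    ultimately have "uniform_limit A (\<lambda>n. blinfun_apply (g n)) (\<lambda>_. 0) sequentially"
      using A by (simp add: almost_limited_def)
    then have "\<forall>\<^sub>F n in sequentially. \<forall>z\<in>A. dist (blinfun_apply (g n) z) 0 < e"
      using \<open>0 < e\<close> by (simp add: uniform_limit_iff)
    then show "\<forall>\<^sub>F n in sequentially. \<forall>y\<in>solid hull A. dist (blinfun_apply (f n) y) 0 < e"
    proof eventually_elim
      case (elim n)
      have "\<bar>blinfun_apply (f n) y\<bar> < e" if "z \<in> A" "\<bar>y\<bar> \<le> \<bar>z\<bar>" for y z
      proof -
        \<comment> \<open>Otherwise \<open>x n\<close> would lie in \<open>A\<close> and
          \<open>g n (x n) \<ge> e\<close>, against the uniform smallness of \<open>g n\<close> on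
          \<open>A\<close>.\<close>
        have "\<not> e \<le> blinfun_apply (dual_abs (f n)) \<bar>z\<bar>"
          using x[OF that(1)] elim g(2)[of n] by force
        then show ?thesis
          using abs_apply_le_dual_abs[of "f n" y] dual_abs_mono[OF _ that(2), of "f n"] by simp
      qed
      then show ?case by (auto simp: solid_hull_eq)
    qed
  qed
qed

lemma property_d_if_intervals_almost_limited:
  assumes "\<And>a b :: 'a::banach_lattice. a \<le> b \<Longrightarrow> almost_limited {a..b}"
  shows "property_d TYPE('a)"
  unfolding property_d_def weak_star_null_iff[of "\<lambda>n. dual_abs (f n)" for f]
proof (intro allI impI)
  fix f :: "nat \<Rightarrow> ('a \<Rightarrow>\<^sub>L real)" and x :: 'a
  assume f: "disjoint_dual_seq f" "weak_star_null f"
  have pos: "(\<lambda>n. blinfun_apply (dual_abs (f n)) x) \<longlonglongrightarrow> 0" if x: "0 \<le> x" for x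
  proof (rule tendstoI)
    fix e :: real assume e: "0 < e"
    have "almost_limited {- x..x}"
      using x by (intro assms) (simp add: minus_le_self_iff)
    then have "\<forall>\<^sub>F n in sequentially. \<forall>y\<in>{- x..x}. dist (blinfun_apply (f n) y) 0 < e / 2"
      using f e unfolding almost_limited_def uniform_limit_iff by (meson half_gt_zero)
    then show "\<forall>\<^sub>F n in sequentially. dist (blinfun_apply (dual_abs (f n)) x) 0 < e"
    proof eventually_elim
      case (elim n)
      \<comment> \<open>A supremum keeps only the weak inequality; starting from
        \<open>e / 2\<close> leaves room for the strict bound by \<open>e\<close>.\<close>
      have "blinfun_apply (dual_abs (f n)) x \<le> e / 2"
      proof (rule dual_abs_apply_le[OF x])
        fix y assume "\<bar>y\<bar> \<le> x"
        then have "y \<in> {- x..x}" by (auto simp: abs_le_iff minus_le_iff)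
        then show "blinfun_apply (f n) y \<le> e / 2" using elim by force
      qed
      then show ?case using dual_abs_nonneg[OF x, of "f n"] e by simp
    qed
  qed
  have "blinfun_apply h x = blinfun_apply h (pprt x) - blinfun_apply h (pprt (- x))"
    for h :: "'a \<Rightarrow>\<^sub>L real"
    by (simp flip: blinfun.diff_right add: pprt_minus_pprt_uminus)
  moreover have "(\<lambda>n. blinfun_apply (dual_abs (f n)) (pprt x)
      - blinfun_apply (dual_abs (f n)) (pprt (- x))) \<longlonglongrightarrow> 0"
    using tendsto_diff[OF pos[of "pprt x"] pos[of "pprt (- x)"]] by simp
  ultimately show "(\<lambda>n. blinfun_apply (dual_abs (f n)) x) \<longlonglongrightarrow> 0" by simp
qed

theorem proposition2p2:
  shows "(property_d TYPE('a::banach_lattice) \<longleftrightarrow>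
           (\<forall>a b :: 'a. a \<le> b \<longrightarrow> almost_limited {a..b})) \<and>
         ((\<forall>a b :: 'a. a \<le> b \<longrightarrow> almost_limited {a..b}) \<longleftrightarrow>
           (\<forall>A :: 'a set. almost_limited A \<longrightarrow> almost_limited (solid hull A)))"
  \<comment> \<open>The cycle runs from (1) to (3), from (3) to (2) through singletons, and from (2)
    back to (1).\<close>
  using almost_limited_solid_hull[where ?'a = 'a]
    property_d_if_intervals_almost_limited[where ?'a = 'a]
    almost_limited_subset[OF _ atLeastAtMost_subset_solid_hull[where ?'a = 'a]]
    almost_limited_singleton[where ?'a = 'a]
  by blast

end
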